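(* Let $q_1,q_2\in[-\tfrac13,1]$ and, for $j=1,2$, let $\mathcal{E}_j$ be the qubit depolarizing channel $\mathcal{E}_j[X]=q_jX+(1-q_j)\,\mathrm{tr}[X]\,\tfrac12 I$ for $X\in M_2(\mathbb{C})$. Then the two-qubit channel $\mathcal{E}_1\otimes\mathcal{E}_2$ is entanglement-annihilating if and only if $q_1q_2\le\tfrac13$.
   Context: A qubit channel is a completely positive trace-preserving linear map on $M_2(\mathbb{C})$; $I$ is the $2\times2$ identity. A state is a positive semidefinite operator of trace one. A two-qubit channel $\mathcal{E}_1\otimes\mathcal{E}_2$ is called entanglement-annihilating (EA) if $(\mathcal{E}_1\otimes\mathcal{E}_2)[\rho]$ is separable (a convex combination of product states with respect to the partition qubit 1 | qubit 2) for every state $\rho$ on $\mathbb{C}^2\otimes\mathbb{C}^2$. *)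

theory Defs
  imports "HOL-Analysis.Analysis"
begin

text \<open>Operators on a finite-dimensional Hilbert space are complex square matrices; the composite
  system of \<open>'m\<close> and \<open>'n\<close> is indexed by \<open>'m \<times> 'n\<close>.\<close>

type_synonym 'n cmatrix = "complex^'n^'n"

type_synonym qubit_op = "2 cmatrix"

type_synonym two_qubit_op = "(2 \<times> 2) cmatrix"

definition hinner :: "complex^'n::finite \<Rightarrow> complex^'n \<Rightarrow> complex" where
  "hinner v w = (\<Sum>i\<in>UNIV. cnj (v $ i) * w $ i)"

definition cscale :: "complex \<Rightarrow> 'n::finite cmatrix \<Rightarrow> 'n cmatrix" (infixr "*\<^sub>C" 75) where
  "c *\<^sub>C A = (\<chi> i j. c * A $ i $ j)"

text \<open>Over the complex numbers, requiring every \<open>hinner v (A *v v)\<close> to be real and nonnegative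
  includes that \<open>A\<close> is Hermitian.\<close>

definition positive_semidefinite :: "'n::finite cmatrix \<Rightarrow> bool" where
  "positive_semidefinite A \<longleftrightarrow> (\<forall>v. hinner v (A *v v) \<in> \<real>\<^sub>\<ge>\<^sub>0)"

definition is_state :: "'n::finite cmatrix \<Rightarrow> bool" where
  "is_state \<rho> \<longleftrightarrow> positive_semidefinite \<rho> \<and> trace \<rho> = 1"

definition kron :: "'m::finite cmatrix \<Rightarrow> 'n::finite cmatrix \<Rightarrow> ('m \<times> 'n) cmatrix" (infixr "\<otimes>\<^sub>K" 70) where
  "A \<otimes>\<^sub>K B = (\<chi> p q. A $ fst p $ fst q * B $ snd p $ snd q)"

definition separable :: "('m::finite \<times> 'n::finite) cmatrix \<Rightarrow> bool" where
  "separable \<rho> \<longleftrightarrow> \<rho> \<in> convex hull {\<sigma> \<otimes>\<^sub>K \<tau> | \<sigma> \<tau>. is_state \<sigma> \<and> is_state \<tau>}"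

definition complex_linear :: "('m::finite cmatrix \<Rightarrow> 'n::finite cmatrix) \<Rightarrow> bool" where
  "complex_linear \<E> \<longleftrightarrow>
    (\<forall>X Y. \<E> (X + Y) = \<E> X + \<E> Y) \<and> (\<forall>c X. \<E> (c *\<^sub>C X) = c *\<^sub>C \<E> X)"

text \<open>An operator on \<open>\<complex>\<^sup>k \<otimes> \<complex>\<^sup>n\<close> is given as a \<open>k \<times> k\<close> array of blocks \<open>X a b\<close>,
  \<open>a, b < k\<close>, and a vector as the sequence of its \<open>k\<close> components in \<open>\<complex>\<^sup>n\<close>; this lets
  complete positivity quantify over the dimension \<open>k\<close> of the ancilla.\<close>

definition block_positive :: "nat \<Rightarrow> (nat \<Rightarrow> nat \<Rightarrow> 'n::finite cmatrix) \<Rightarrow> bool" where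
  "block_positive k X \<longleftrightarrow>
    (\<forall>v :: nat \<Rightarrow> complex^'n. (\<Sum>a<k. \<Sum>b<k. hinner (v a) (X a b *v v b)) \<in> \<real>\<^sub>\<ge>\<^sub>0)"

definition completely_positive :: "('m::finite cmatrix \<Rightarrow> 'n::finite cmatrix) \<Rightarrow> bool" where
  "completely_positive \<E> \<longleftrightarrow>
    (\<forall>k X. block_positive k X \<longrightarrow> block_positive k (\<lambda>a b. \<E> (X a b)))"

definition trace_preserving :: "('m::finite cmatrix \<Rightarrow> 'n::finite cmatrix) \<Rightarrow> bool" where
  "trace_preserving \<E> \<longleftrightarrow> (\<forall>X. trace (\<E> X) = trace X)"

definition qubit_channel :: "(qubit_op \<Rightarrow> qubit_op) \<Rightarrow> bool" where
  "qubit_channel \<E> \<longleftrightarrow> complex_linear \<E> \<and> completely_positive \<E> \<and> trace_preserving \<E>"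

definition matrix_unit :: "'n::finite \<Rightarrow> 'n \<Rightarrow> 'n cmatrix" where
  "matrix_unit i j = (\<chi> k l. if k = i \<and> l = j then 1 else 0)"

text \<open>The tensor product of linear maps, expanded in the basis of products of matrix units;
  \<open>tensor_map_kron\<close> and \<open>tensor_map_unique\<close> below give its defining property.\<close>

definition tensor_map ::
  "('m::finite cmatrix \<Rightarrow> 'm cmatrix) \<Rightarrow> ('n::finite cmatrix \<Rightarrow> 'n cmatrix) \<Rightarrow>
   ('m \<times> 'n) cmatrix \<Rightarrow> ('m \<times> 'n) cmatrix" (infixr "\<otimes>\<^sub>M" 70) where
  "(\<E> \<otimes>\<^sub>M \<F>) X = (\<Sum>p\<in>UNIV. \<Sum>q\<in>UNIV. X $ p $ q *\<^sub>C
      (\<E> (matrix_unit (fst p) (fst q)) \<otimes>\<^sub>K \<F> (matrix_unit (snd p) (snd q))))"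

definition entanglement_annihilating ::
  "(qubit_op \<Rightarrow> qubit_op) \<Rightarrow> (qubit_op \<Rightarrow> qubit_op) \<Rightarrow> bool" where
  "entanglement_annihilating \<E>1 \<E>2 \<longleftrightarrow>
    qubit_channel \<E>1 \<and> qubit_channel \<E>2 \<and>
    (\<forall>\<rho> :: two_qubit_op. is_state \<rho> \<longrightarrow> separable ((\<E>1 \<otimes>\<^sub>M \<E>2) \<rho>))"

definition depolarizing :: "real \<Rightarrow> qubit_op \<Rightarrow> qubit_op" where
  "depolarizing q X = q *\<^sub>R X + (1 - q) *\<^sub>R (trace X *\<^sub>C ((1/2) *\<^sub>R mat 1))"

lemma cscale_zero_left: "0 *\<^sub>C X = 0"
  by (simp add: cscale_def vec_eq_iff)

lemma cmatrix_expansion: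
  fixes X :: "'n::finite cmatrix"
  shows "X = (\<Sum>i\<in>UNIV. \<Sum>j\<in>UNIV. X $ i $ j *\<^sub>C matrix_unit i j)"
proof -
  have "(\<Sum>i\<in>UNIV. \<Sum>j\<in>UNIV. X $ i $ j *\<^sub>C matrix_unit i j) $ k $ l = X $ k $ l" for k l
  proof -
    have "(\<Sum>i\<in>UNIV. \<Sum>j\<in>UNIV. X $ i $ j *\<^sub>C matrix_unit i j) $ k $ l =
      (\<Sum>i\<in>UNIV. \<Sum>j\<in>UNIV. if i = k then (if j = l then X $ i $ j else 0) else 0)"
      by (auto simp: cscale_def matrix_unit_def intro!: sum.cong)
    also have "\<dots> = (\<Sum>i\<in>UNIV. if i = k then (\<Sum>j\<in>UNIV. if j = l then X $ i $ j else 0) else 0)"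
      by (intro sum.cong) auto
    also have "\<dots> = X $ k $ l" by simp
    finally show ?thesis .
  qed
  then show ?thesis by (simp add: vec_eq_iff)
qed

lemma complex_linear_sum:
  assumes "complex_linear \<E>" "finite S"
  shows "\<E> (\<Sum>i\<in>S. f i) = (\<Sum>i\<in>S. \<E> (f i))"
proof -
  have "\<E> (0 *\<^sub>C 0) = 0 *\<^sub>C \<E> 0" using assms(1) unfolding complex_linear_def by blast
  then have z: "\<E> 0 = 0" by (simp add: cscale_zero_left)
  show ?thesis using assms(2)
    by (induction S rule: finite_induct) (use assms(1) z in \<open>auto simp: complex_linear_def\<close>)
qed

lemma complex_linear_expansion:
  fixes X :: "'n::finite cmatrix"
  assumes "complex_linear \<E>"
  shows "\<E> X = (\<Sum>i\<in>UNIV. \<Sum>j\<in>UNIV. X $ i $ j *\<^sub>C \<E> (matrix_unit i j))"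
proof -
  have "\<E> X = \<E> (\<Sum>i\<in>UNIV. \<Sum>j\<in>UNIV. X $ i $ j *\<^sub>C matrix_unit i j)"
    using cmatrix_expansion[of X] by simp
  also have "\<dots> = (\<Sum>i\<in>UNIV. \<Sum>j\<in>UNIV. \<E> (X $ i $ j *\<^sub>C matrix_unit i j))"
    by (simp add: complex_linear_sum[OF assms])
  finally show ?thesis using assms by (simp add: complex_linear_def)
qed

lemma sum_UNIV_prod:
  "(\<Sum>p\<in>UNIV. f p) = (\<Sum>a\<in>UNIV. \<Sum>b\<in>UNIV. f (a, b))"
  by (simp add: sum.cartesian_product)

lemma kron_matrix_unit: "matrix_unit a b \<otimes>\<^sub>K matrix_unit c d = matrix_unit (a, c) (b, d)"
  by (auto simp: kron_def matrix_unit_def vec_eq_iff prod_eq_iff)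

lemma complex_linear_tensor_map: "complex_linear (\<E> \<otimes>\<^sub>M \<F>)"
  unfolding complex_linear_def tensor_map_def
  by (auto simp: vec_eq_iff cscale_def sum.distrib sum_distrib_left algebra_simps)

lemma tensor_map_kron:
  assumes "complex_linear \<E>" "complex_linear \<F>"
  shows "(\<E> \<otimes>\<^sub>M \<F>) (A \<otimes>\<^sub>K B) = \<E> A \<otimes>\<^sub>K \<F> B"
proof -
  have "(\<E> A \<otimes>\<^sub>K \<F> B) $ r $ s = ((\<E> \<otimes>\<^sub>M \<F>) (A \<otimes>\<^sub>K B)) $ r $ s" for r s
  proof -
    let ?e = "\<lambda>i j. A $ i $ j * \<E> (matrix_unit i j) $ fst r $ fst s"
    let ?f = "\<lambda>k l. B $ k $ l * \<F> (matrix_unit k l) $ snd r $ snd s"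
    have "(\<E> A \<otimes>\<^sub>K \<F> B) $ r $ s = (\<Sum>i\<in>UNIV. \<Sum>j\<in>UNIV. ?e i j) * (\<Sum>k\<in>UNIV. \<Sum>l\<in>UNIV. ?f k l)"
      unfolding kron_def
      by (subst complex_linear_expansion[OF assms(1), of A],
          subst complex_linear_expansion[OF assms(2), of B]) (simp add: cscale_def)
    also have "\<dots> = (\<Sum>i\<in>UNIV. \<Sum>k\<in>UNIV. (\<Sum>j\<in>UNIV. ?e i j) * (\<Sum>l\<in>UNIV. ?f k l))"
      by (simp add: sum_product)
    also have "\<dots> = (\<Sum>i\<in>UNIV. \<Sum>k\<in>UNIV. \<Sum>j\<in>UNIV. \<Sum>l\<in>UNIV. ?e i j * ?f k l)"
      by (simp only: sum_product)
    also have "\<dots> = (\<Sum>p\<in>UNIV. \<Sum>q\<in>UNIV. ?e (fst p) (fst q) * ?f (snd p) (snd q))"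
      by (simp only: sum_UNIV_prod fst_conv snd_conv)
    also have "\<dots> = ((\<E> \<otimes>\<^sub>M \<F>) (A \<otimes>\<^sub>K B)) $ r $ s"
      by (simp add: tensor_map_def kron_def cscale_def mult_ac)
    finally show ?thesis .
  qed
  then show ?thesis by (simp add: vec_eq_iff)
qed

lemma tensor_map_unique:
  assumes "complex_linear \<G>" "\<And>A B. \<G> (A \<otimes>\<^sub>K B) = \<E> A \<otimes>\<^sub>K \<F> B"
  shows "\<G> = \<E> \<otimes>\<^sub>M \<F>"
proof
  fix X
  have "\<G> (matrix_unit p q) =
      \<E> (matrix_unit (fst p) (fst q)) \<otimes>\<^sub>K \<F> (matrix_unit (snd p) (snd q))" for p q
    using assms(2)[of "matrix_unit (fst p) (fst q)" "matrix_unit (snd p) (snd q)"]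
    by (simp add: kron_matrix_unit)
  then show "\<G> X = (\<E> \<otimes>\<^sub>M \<F>) X"
    unfolding complex_linear_expansion[OF assms(1), of X] tensor_map_def by simp
qed

lemma complex_linear_depolarizing: "complex_linear (depolarizing q)"
  unfolding complex_linear_def depolarizing_def
  by (auto simp: vec_eq_iff cscale_def trace_def sum.distrib sum_distrib_left mat_def
      scaleR_conv_of_real[where 'a=complex] algebra_simps)

lemma trace_preserving_depolarizing: "trace_preserving (depolarizing q)"
  unfolding trace_preserving_def depolarizing_def
  by (auto simp: cscale_def trace_def sum_2 mat_def scaleR_conv_of_real[where 'a=complex] algebra_simps)

text \<open>Complete positivity via the Pauli (Kraus) form of the depolarizing map.\<close>

lemma depolarizing_form:
  fixes v w :: "complex^2" and X :: qubit_op
  shows "hinner v (depolarizing q X *v w) =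
    of_real ((1 + 3*q)/4) * hinner v (X *v w) +
    of_real ((1 - q)/4) *
     (hinner (vector [v$2, v$1]) (X *v vector [w$2, w$1]) +
      hinner (vector [- \<i> * v$2, \<i> * v$1]) (X *v vector [- \<i> * w$2, \<i> * w$1]) +
      hinner (vector [v$1, - v$2]) (X *v vector [w$1, - w$2]))"
  by (simp add: hinner_def depolarizing_def cscale_def trace_def sum_2 mat_def
      matrix_vector_mult_def scaleR_conv_of_real[where 'a=complex] field_simps)

lemma completely_positive_depolarizing:
  assumes "q \<in> {- 1/3..1}"
  shows "completely_positive (depolarizing q)"
  unfolding completely_positive_def block_positive_def
proof (intro allI impI)
  fix k :: nat and X :: "nat \<Rightarrow> nat \<Rightarrow> qubit_op" and v :: "nat \<Rightarrow> complex^2"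
  assume pos: "\<forall>v. (\<Sum>a<k. \<Sum>b<k. hinner (v a) (X a b *v v b)) \<in> \<real>\<^sub>\<ge>\<^sub>0"
  define Q where "Q = (\<lambda>u. \<Sum>a<k. \<Sum>b<k. hinner (u a) (X a b *v u b))"
  have Q: "Q u \<in> \<real>\<^sub>\<ge>\<^sub>0" for u using pos by (simp add: Q_def)
  have "(\<Sum>a<k. \<Sum>b<k. hinner (v a) (depolarizing q (X a b) *v v b)) =
    of_real ((1 + 3*q)/4) * Q v + of_real ((1 - q)/4) *
     (Q (\<lambda>a. vector [v a$2, v a$1]) + Q (\<lambda>a. vector [- \<i> * v a$2, \<i> * v a$1]) +
      Q (\<lambda>a. vector [v a$1, - v a$2]))"
    unfolding Q_def depolarizing_form by (simp only: sum.distrib sum_distrib_left distrib_left)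
  also have "\<dots> \<in> \<real>\<^sub>\<ge>\<^sub>0"
    by (intro nonneg_Reals_add_I nonneg_Reals_mult_I Q
        nonneg_Reals_of_real_iff[THEN iffD2]) (use assms in auto)
  finally show "(\<Sum>a<k. \<Sum>b<k. hinner (v a) (depolarizing q (X a b) *v v b)) \<in> \<real>\<^sub>\<ge>\<^sub>0" .
qed

lemma qubit_channel_depolarizing:
  "q \<in> {- 1/3..1} \<Longrightarrow> qubit_channel (depolarizing q)"
  by (simp add: qubit_channel_def complex_linear_depolarizing completely_positive_depolarizing
      trace_preserving_depolarizing)

end

theory Submission imports Defs begin

text \<open>A state is a sum of rank-one projections (iterated Schur complements), and by the Schmidt
  decomposition each of them is \<open>\<psi> \<psi>\<^sup>*\<close> with \<open>\<psi> = a u \<otimes> v + b u' \<otimes> v'\<close> for orthonormal bases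
  \<open>u, u'\<close> and \<open>v, v'\<close>. In the product basis the depolarized operator is X-shaped: besides its
  diagonal \<open>d\<^sub>0\<^sub>0, d\<^sub>0\<^sub>1, d\<^sub>1\<^sub>0, d\<^sub>1\<^sub>1\<close> it has only the coherence \<open>r = a b\<^sup>* q\<^sub>1 q\<^sub>2\<close> between \<open>u \<otimes> v\<close> and
  \<open>u' \<otimes> v'\<close>. With \<open>q = q\<^sub>1 q\<^sub>2\<close>, one has \<open>d\<^sub>0\<^sub>0 d\<^sub>1\<^sub>1 \<ge> |a b|\<^sup>2 (1 + q)\<^sup>2 / 4\<close> and
  \<open>d\<^sub>0\<^sub>1 d\<^sub>1\<^sub>0 \<ge> |a b|\<^sup>2 (1 - q)\<^sup>2 / 4\<close>, so for \<open>-1/3 \<le> q \<le> 1/3\<close> both products dominate \<open>|r|\<^sup>2\<close>, and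
  such an operator is a phase average of product vectors plus a nonnegative diagonal.
  Conversely, the overlap of a product state with the maximally entangled state is at most
  \<open>1/2\<close>, whereas that state is mapped to one with overlap \<open>(1 + 3 q) / 4\<close>.\<close>

section \<open>Positive semidefinite matrices\<close>

definition outer :: "complex^'n::finite \<Rightarrow> complex^'n \<Rightarrow> 'n cmatrix" where
  "outer v w = (\<chi> i j. v $ i * cnj (w $ j))"

lemma hinner_add_right: "hinner v (x + y) = hinner v x + hinner v y"
  by (simp add: hinner_def algebra_simps sum.distrib)

lemma hinner_diff_right: "hinner v (x - y) = hinner v x - hinner v y"
  by (simp add: hinner_def algebra_simps sum_subtractf)

lemma hinner_add_left: "hinner (x + y) v = hinner x v + hinner y v"
  by (simp add: hinner_def algebra_simps sum.distrib)

lemma hinner_smult_right: "hinner v (c *s x) = c * hinner v x"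
  by (simp add: hinner_def sum_distrib_left mult_ac)

lemma hinner_smult_left: "hinner (c *s x) v = cnj c * hinner x v"
  by (simp add: hinner_def sum_distrib_left mult_ac)

lemma hinner_axis: "hinner (axis i 1) x = x $ i"
proof -
  have "hinner (axis i 1) x = (\<Sum>k\<in>UNIV. if k = i then x $ i else 0)"
    unfolding hinner_def by (intro sum.cong) (auto simp: axis_def)
  then show ?thesis by simp
qed

lemma matrix_vector_mult_axis: "(A :: 'n::finite cmatrix) *v axis j 1 = column j A"
proof -
  have "(A *v axis j 1) $ i = (\<Sum>k\<in>UNIV. if k = j then A $ i $ j else 0)" for i
    unfolding matrix_vector_mult_def vec_lambda_beta
    by (intro sum.cong) (auto simp: axis_def)
  then show ?thesis by (simp add: vec_eq_iff column_def)
qed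

lemma hinner_outer: "hinner v (outer x y *v v) = hinner v x * cnj (hinner v y)"
  unfolding hinner_def outer_def matrix_vector_mult_def
  by (simp add: sum_distrib_left sum_distrib_right sum_product mult_ac)

lemma hinner_scaleR_matrix: "hinner v ((c *\<^sub>R A) *v w) = of_real c * hinner v (A *v w)"
  unfolding hinner_def matrix_vector_mult_def
  by (simp add: sum_distrib_left scaleR_conv_of_real[where 'a=complex] mult_ac)

lemma psd_outer: "positive_semidefinite (outer x x)"
  by (simp add: positive_semidefinite_def hinner_outer complex_norm_square[symmetric]
      del: of_real_power)

lemma psd_scaleR: "positive_semidefinite A \<Longrightarrow> 0 \<le> c \<Longrightarrow> positive_semidefinite (c *\<^sub>R A)"
  by (simp add: positive_semidefinite_def hinner_scaleR_matrix nonneg_Reals_mult_I)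

context
  fixes A :: "'n::finite cmatrix"
  assumes psd: "positive_semidefinite A"
begin

text \<open>This is the quadratic form at \<open>v + c *s axis i 1\<close>. Suitable choices of the
  free scalar \<open>c\<close> give hermiticity, Schur complements and the minor bound.\<close>

lemma psd_quadratic:
  "hinner v (A *v v) + c * hinner v (column i A) + cnj c * (A *v v) $ i + cnj c * c * A $ i $ i
    \<in> \<real>\<^sub>\<ge>\<^sub>0"
proof -
  let ?w = "v + c *s axis i 1"
  have "hinner ?w (A *v ?w) \<in> \<real>\<^sub>\<ge>\<^sub>0" using psd by (simp add: positive_semidefinite_def)
  also have "hinner ?w (A *v ?w) =
      hinner v (A *v v) + c * hinner v (column i A) + cnj c * (A *v v) $ i
        + cnj c * c * A $ i $ i"
    by (simp add: matrix_vector_right_distrib vector_scalar_commute hinner_add_left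
        hinner_add_right hinner_smult_left hinner_smult_right hinner_axis
        matrix_vector_mult_axis column_def algebra_simps)
  finally show ?thesis .
qed

lemma psd_diag: "A $ i $ i \<in> \<real>\<^sub>\<ge>\<^sub>0"
  using psd_quadratic[of 0 1 i] by (simp add: hinner_def)

text \<open>All values in \<open>psd_quadratic\<close> are real. For the two cross terms
  \<open>x\<close>, \<open>y\<close>, the choice \<open>c = 1\<close> gives
  \<open>Im (x + y) = 0\<close> and \<open>c = \<i>\<close> gives \<open>Re x = Re y\<close>. Taking
  an axis vector for \<open>v\<close> then yields hermiticity.\<close>

lemma psd_cross: "hinner v (column i A) = cnj ((A *v v) $ i)"
proof -
  define x y where "x = hinner v (column i A)" and "y = (A *v v) $ i"
  have R: "hinner v (A *v v) \<in> \<real>" "A $ i $ i \<in> \<real>"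
    using psd psd_diag[of i] by (auto simp: positive_semidefinite_def nonneg_Reals_subset_Reals[THEN subsetD])
  have Im0: "Im (hinner v (A *v v)) = 0" "Im (A $ i $ i) = 0"
    using R by (simp_all add: complex_is_Real_iff)
  have "Im (x + y) = 0"
    using psd_quadratic[of v 1 i] Im0 by (simp add: x_def y_def complex_nonneg_Reals_iff)
  moreover have "Re x = Re y"
    using psd_quadratic[of v \<i> i] Im0 by (simp add: x_def y_def complex_nonneg_Reals_iff)
  ultimately show ?thesis
    by (simp add: x_def[symmetric] y_def[symmetric] complex_eq_iff)
qed

lemma psd_hermitian: "A $ j $ i = cnj (A $ i $ j)"
  using psd_cross[of "axis j 1" i] by (simp add: hinner_axis matrix_vector_mult_axis column_def)

text \<open>Completing the square: with \<open>z = (A *v v) $ i\<close> and \<open>d\<close> the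
  pivot, \<open>c = - z / d\<close> minimizes the form in \<open>psd_quadratic\<close>, and the
  minimum is the form of the Schur complement at \<open>v\<close>.\<close>

lemma psd_schur_complement:
  assumes "A $ i $ i \<noteq> 0"
  shows "positive_semidefinite (A - inverse (Re (A $ i $ i)) *\<^sub>R outer (column i A) (column i A))"
  unfolding positive_semidefinite_def
proof
  fix v
  define z d where "z = (A *v v) $ i" and "d = Re (A $ i $ i)"
  have d: "A $ i $ i = of_real d" "d \<noteq> 0"
    using psd_diag[of i] assms by (auto simp: d_def complex_nonneg_Reals_iff complex_eq_iff)
  have "hinner v ((A - inverse d *\<^sub>R outer (column i A) (column i A)) *v v) =
      hinner v (A *v v) - of_real (inverse d) * (cnj z * z)"
    by (simp add: matrix_vector_mult_diff_rdistrib hinner_diff_right hinner_scaleR_matrix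
        hinner_outer psd_cross z_def)
  also have "\<dots> = hinner v (A *v v) + (- z / of_real d) * cnj z + cnj (- z / of_real d) * z
      + cnj (- z / of_real d) * (- z / of_real d) * A $ i $ i"
    using d by (simp add: field_simps)
  also have "\<dots> \<in> \<real>\<^sub>\<ge>\<^sub>0"
    using psd_quadratic[of v "- z / of_real d" i] by (simp add: psd_cross z_def)
  finally show "hinner v ((A - inverse (Re (A $ i $ i)) *\<^sub>R outer (column i A) (column i A)) *v v)
      \<in> \<real>\<^sub>\<ge>\<^sub>0"
    by (simp add: d_def)
qed

end

text \<open>For a nonzero pivot this says that the \<open>j\<close>-th diagonal entry of the Schur
  complement is nonnegative. For a zero pivot the form is affine along the direction
  \<open>i\<close>, so a nonzero entry \<open>A $ i $ j\<close> would make it negative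
  somewhere.\<close>

lemma psd_minor:
  assumes psd: "positive_semidefinite A"
  shows "(cmod (A $ i $ j))\<^sup>2 \<le> Re (A $ i $ i) * Re (A $ j $ j)"
proof (cases "A $ i $ i = 0")
  case False
  define d where "d = Re (A $ i $ i)"
  have d: "d > 0" using psd_diag[OF psd, of i] False
    by (auto simp: d_def complex_nonneg_Reals_iff complex_eq_iff less_le)
  have "0 \<le> Re (A $ j $ j - of_real (inverse d) * (A $ j $ i * cnj (A $ j $ i)))"
    using psd_diag[OF psd_schur_complement[OF psd False], of j]
    by (simp add: outer_def column_def complex_nonneg_Reals_iff d_def
        scaleR_conv_of_real[where 'a=complex] del: of_real_inverse)
  also have "A $ j $ i * cnj (A $ j $ i) = of_real ((cmod (A $ i $ j))\<^sup>2)"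
    using psd_hermitian[OF psd, of j i] by (simp only: complex_norm_square) (simp add: mult.commute)
  finally show ?thesis using d by (simp add: d_def[symmetric] field_simps)
next
  case True
  have "A $ i $ j = 0"
  proof (rule ccontr)
    assume nz: "A $ i $ j \<noteq> 0"
    define z D where "z = A $ i $ j" and "D = Re (A $ j $ j)"
    define m where "m = (cmod z)\<^sup>2"
    have m: "m > 0" using nz by (simp add: m_def z_def)
    \<comment> \<open>Chosen so that \<open>t * m = - (D + 1)\<close>: the form then takes the value
      \<open>D - 2 * (D + 1)\<close>, which is negative because \<open>D \<ge> 0\<close>.\<close>
    define t where "t = - (D + 1) / m"
    have Azz: "cnj z * z = of_real m" "z * cnj z = of_real m"
      by (simp_all only: m_def complex_norm_square mult.commute)
    have h: "A $ j $ i = cnj z" using psd_hermitian[OF psd, of j i] by (simp add: z_def)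
    have "A $ j $ j + (of_real t * z) * cnj z + cnj (of_real t * z) * z \<in> \<real>\<^sub>\<ge>\<^sub>0"
      using psd_quadratic[OF psd, of "axis j 1" "of_real t * z" i] True h
      by (simp add: hinner_axis matrix_vector_mult_axis column_def z_def)
    also have "A $ j $ j + (of_real t * z) * cnj z + cnj (of_real t * z) * z =
        A $ j $ j + of_real (2 * t * m)"
      using Azz by (simp add: mult.assoc)
    finally have "0 \<le> D + 2 * (t * m)" by (simp add: complex_nonneg_Reals_iff D_def)
    moreover have "t * m = - (D + 1)" using m by (simp add: t_def)
    moreover have "D \<ge> 0" using psd_diag[OF psd, of j] by (simp add: D_def complex_nonneg_Reals_iff)
    ultimately show False by simp
  qed
  then show ?thesis using True by simp
qed

text \<open>Induction on the number of nonzero diagonal entries. Passing to the Schur complement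
  clears the pivot, and it creates no new nonzero diagonal entry because, by
  \<open>psd_minor\<close>, a zero diagonal entry has a zero row. What is split off is a rank-one
  term.\<close>

lemma psd_rank_one_induct [consumes 1, case_names zero add]:
  assumes "positive_semidefinite A"
    and zero: "P 0"
    and add: "\<And>M \<psi>. P M \<Longrightarrow> P (M + outer \<psi> \<psi>)"
  shows "P A"
  using assms(1)
proof (induction "card {i. A $ i $ i \<noteq> 0}" arbitrary: A rule: less_induct)
  case less
  note psd = less.prems
  show ?case
  proof (cases "\<exists>i. A $ i $ i \<noteq> 0")
    case False
    then have "A $ i $ j = 0" for i j using psd_minor[OF psd, of i j] by simp
    then have "A = 0" by (simp add: vec_eq_iff)
    then show ?thesis using zero by simp
  next
    case True
    then obtain i where i: "A $ i $ i \<noteq> 0" by blast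
    define d where "d = Re (A $ i $ i)"
    have d: "A $ i $ i = of_real d" "d > 0"
      using psd_diag[OF psd, of i] i
      by (auto simp: d_def complex_nonneg_Reals_iff complex_eq_iff less_le)
    let ?B = "A - inverse d *\<^sub>R outer (column i A) (column i A)"
    have "{j. ?B $ j $ j \<noteq> 0} \<subset> {j. A $ j $ j \<noteq> 0}"
    proof
      have "A $ j $ i = 0" if "A $ j $ j = 0" for j
        using psd_minor[OF psd, of j i] that by simp
      then show "{j. ?B $ j $ j \<noteq> 0} \<subseteq> {j. A $ j $ j \<noteq> 0}"
        by (auto simp: outer_def column_def)
      have "?B $ i $ i = 0" using d by (simp add: outer_def column_def scaleR_conv_of_real[where 'a=complex])
      then show "{j. ?B $ j $ j \<noteq> 0} \<noteq> {j. A $ j $ j \<noteq> 0}" using i by blast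
    qed
    then have "card {j. ?B $ j $ j \<noteq> 0} < card {j. A $ j $ j \<noteq> 0}"
      by (intro psubset_card_mono) auto
    then have "P ?B"
      using less.hyps psd_schur_complement[OF psd i] by (simp add: d_def)
    moreover have "?B + outer (of_real (1 / sqrt d) *s column i A) (of_real (1 / sqrt d) *s column i A) = A"
    proof -
      have "outer (of_real (1 / sqrt d) *s x) (of_real (1 / sqrt d) *s x) = inverse d *\<^sub>R outer x x"
        for x :: "complex^'a"
      proof -
        have "complex_of_real (sqrt d) * of_real (sqrt d) = of_real d"
          using d by (simp flip: of_real_mult)
        then show ?thesis
          using d by (simp add: outer_def vec_eq_iff scaleR_conv_of_real[where 'a=complex] field_simps)
      qed
      then show ?thesis by simp
    qed
    ultimately show ?thesis by (metis add)
  qed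
qed

section \<open>The cone of separable operators\<close>

text \<open>The unnormalized counterpart of \<open>separable\<close>: sums need no convex weights,
  so rank-one pieces and diagonal remainders can be added freely. The trace is restored only at the
  end, in \<open>separable_if_sep_cone\<close>.\<close>

inductive sep_cone :: "('m::finite \<times> 'n::finite) cmatrix \<Rightarrow> bool" where
  zero: "sep_cone 0"
| kron: "positive_semidefinite A \<Longrightarrow> positive_semidefinite B \<Longrightarrow> sep_cone (A \<otimes>\<^sub>K B)"
| add: "sep_cone M \<Longrightarrow> sep_cone N \<Longrightarrow> sep_cone (M + N)"

lemma kron_scaleR: "(c *\<^sub>R A) \<otimes>\<^sub>K B = c *\<^sub>R (A \<otimes>\<^sub>K B)" "A \<otimes>\<^sub>K (c *\<^sub>R B) = c *\<^sub>R (A \<otimes>\<^sub>K B)"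
  by (simp_all add: kron_def vec_eq_iff)

lemma sep_cone_scaleR: "sep_cone M \<Longrightarrow> 0 \<le> c \<Longrightarrow> sep_cone (c *\<^sub>R M)"
proof (induction rule: sep_cone.induct)
  case (kron A B)
  then show ?case using sep_cone.kron[OF psd_scaleR[of A c] kron(2)] by (simp add: kron_scaleR)
qed (auto simp: scaleR_add_right intro: sep_cone.zero sep_cone.add)

lemma psd_trace:
  assumes "positive_semidefinite A"
  shows "trace A \<in> \<real>\<^sub>\<ge>\<^sub>0"
  using psd_diag[OF assms] by (simp add: trace_def complex_nonneg_Reals_iff sum_nonneg)

lemma trace_scaleR: "trace (c *\<^sub>R A) = of_real c * trace (A :: 'n::finite cmatrix)"
  by (simp add: trace_def sum_distrib_left scaleR_conv_of_real[where 'a=complex])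

text \<open>If the trace vanishes, so does each nonnegative diagonal entry, and
  \<open>psd_minor\<close> then kills all other entries. Hence a nonzero \<open>A\<close> has
  positive trace and can be divided by it.\<close>

lemma psd_normalize:
  assumes psd: "positive_semidefinite A" and "A \<noteq> 0"
  obtains t \<sigma> where "t > 0" "is_state \<sigma>" "A = t *\<^sub>R \<sigma>"
proof -
  define t where "t = Re (trace A)"
  have tr: "trace A = of_real t" "t \<ge> 0"
    using psd_trace[OF psd] by (auto simp: t_def complex_nonneg_Reals_iff complex_eq_iff)
  have "t \<noteq> 0"
  proof
    assume "t = 0"
    then have "(\<Sum>i\<in>UNIV. Re (A $ i $ i)) = 0" by (simp add: t_def trace_def)
    then have "Re (A $ i $ i) = 0" for i
      using psd_diag[OF psd] by (subst (asm) sum_nonneg_eq_0_iff) (auto simp: complex_nonneg_Reals_iff)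
    then have "A $ i $ j = 0" for i j using psd_minor[OF psd, of i j] by simp
    then show False using \<open>A \<noteq> 0\<close> by (simp add: vec_eq_iff)
  qed
  with tr have t: "t > 0" by simp
  have "is_state (inverse t *\<^sub>R A)"
    using t psd tr by (simp add: is_state_def psd_scaleR trace_scaleR)
  moreover have "A = t *\<^sub>R inverse t *\<^sub>R A" using t by simp
  ultimately show thesis using that t by blast
qed

lemma trace_kron: "trace (A \<otimes>\<^sub>K B) = trace A * trace B"
  by (simp add: trace_def kron_def sum_UNIV_prod sum_product)

text \<open>For sums, \<open>s *\<^sub>R \<sigma> + t *\<^sub>R \<tau>\<close> is
  \<open>s + t\<close> times the convex combination with weights \<open>s / (s + t)\<close> and
  \<open>t / (s + t)\<close>.\<close>

lemma sep_cone_normalize: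
  "sep_cone M \<Longrightarrow> M = 0 \<or> (\<exists>t \<rho>. t > 0 \<and> separable \<rho> \<and> trace \<rho> = 1 \<and> M = t *\<^sub>R \<rho>)"
proof (induction rule: sep_cone.induct)
  case (kron A B)
  show ?case
  proof (cases "A = 0 \<or> B = 0")
    case True
    then have "A \<otimes>\<^sub>K B = 0" by (auto simp: kron_def vec_eq_iff)
    then show ?thesis by simp
  next
    case False
    obtain s \<sigma> where s: "s > 0" "is_state \<sigma>" "A = s *\<^sub>R \<sigma>" using psd_normalize kron(1) False by blast
    obtain t \<tau> where t: "t > 0" "is_state \<tau>" "B = t *\<^sub>R \<tau>" using psd_normalize kron(2) False by blast
    have "separable (\<sigma> \<otimes>\<^sub>K \<tau>)" unfolding separable_def by (rule hull_inc) (use s t in blast)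
    moreover have "trace (\<sigma> \<otimes>\<^sub>K \<tau>) = 1" using s t by (simp add: trace_kron is_state_def)
    moreover have "A \<otimes>\<^sub>K B = (s * t) *\<^sub>R (\<sigma> \<otimes>\<^sub>K \<tau>)" using s t by (simp add: kron_scaleR)
    ultimately show ?thesis using s t mult_pos_pos by blast
  qed
next
  case (add M N)
  show ?case
  proof (cases "M = 0 \<or> N = 0")
    case True
    then show ?thesis using add.IH by auto
  next
    case False
    obtain s \<sigma> where s: "s > 0" "separable \<sigma>" "trace \<sigma> = 1" "M = s *\<^sub>R \<sigma>" using add.IH False by blast
    obtain t \<tau> where t: "t > 0" "separable \<tau>" "trace \<tau> = 1" "N = t *\<^sub>R \<tau>" using add.IH False by blast
    let ?\<rho> = "(s / (s + t)) *\<^sub>R \<sigma> + (t / (s + t)) *\<^sub>R \<tau>"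
    have sum1: "s / (s + t) + t / (s + t) = 1" using s t by (simp add: add_divide_distrib[symmetric])
    have "separable ?\<rho>"
      using s t sum1 unfolding separable_def by (intro convexD[OF convex_convex_hull]) auto
    moreover have "trace ?\<rho> = of_real (s / (s + t) + t / (s + t))"
      using s t by (simp only: trace_add trace_scaleR of_real_add mult_1_right)
    moreover have "M + N = (s + t) *\<^sub>R ?\<rho>" using s t by (simp add: scaleR_add_right)
    ultimately show ?thesis using s t sum1 add_pos_pos of_real_1 by metis
  qed
qed simp

lemma separable_if_sep_cone:
  assumes "sep_cone M" "trace M = 1"
  shows "separable M"
proof -
  have "M \<noteq> 0" using assms(2) by (auto simp: trace_def)
  then obtain t \<rho> where t: "separable \<rho>" "trace \<rho> = 1" "M = t *\<^sub>R \<rho>"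
    using sep_cone_normalize[OF assms(1)] by blast
  then have "t = 1" using assms(2) by (simp add: trace_scaleR)
  then show ?thesis using t by simp
qed

section \<open>Schmidt decomposition of two qubits\<close>

text \<open>The antiunitary spin flip: orthogonal to \<open>u\<close> and of the same norm, so a
  unit \<open>u\<close> and \<open>perp u\<close> form an orthonormal basis.\<close>

definition perp :: "complex^2 \<Rightarrow> complex^2" where
  "perp u = vector [- cnj (u $ 2), cnj (u $ 1)]"

text \<open>The quadratic formula at \<open>y = 1\<close> gives a root \<open>z\<close>. The form is
  homogeneous, so \<open>(z, 1)\<close> may be scaled to unit length.\<close>

lemma binary_quadratic_form_isotropic:
  fixes \<alpha> \<beta> \<gamma> :: complex
  obtains x y where "x * cnj x + y * cnj y = 1" "\<alpha> * x\<^sup>2 + \<beta> * x * y + \<gamma> * y\<^sup>2 = 0"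
proof (cases "\<alpha> = 0")
  case True
  then show thesis using that[of 1 0] by simp
next
  case False
  define D where "D = csqrt (\<beta>\<^sup>2 - 4 * \<alpha> * \<gamma>)"
  have D: "D\<^sup>2 = \<beta>\<^sup>2 - 4 * \<alpha> * \<gamma>" by (simp add: D_def)
  define z where "z = (D - \<beta>) / (2 * \<alpha>)"
  have az: "2 * \<alpha> * z = D - \<beta>" using False by (simp add: z_def)
  have "4 * \<alpha> * (\<alpha> * z\<^sup>2 + \<beta> * z + \<gamma>) = (2 * \<alpha> * z + \<beta>)\<^sup>2 - (\<beta>\<^sup>2 - 4 * \<alpha> * \<gamma>)"
    by (simp add: power2_eq_square algebra_simps)
  also have "\<dots> = 0" using az D by simp
  finally have z: "\<alpha> * z\<^sup>2 + \<beta> * z + \<gamma> = 0" using False by simp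
  define n where "n = complex_of_real (sqrt (1 + (cmod z)\<^sup>2))"
  have "1 + (cmod z)\<^sup>2 > 0" by (simp add: add_pos_nonneg)
  then have n: "n \<noteq> 0" "cnj n = n" "n * n = 1 + z * cnj z"
    by (simp_all add: n_def complex_norm_square[symmetric] flip: of_real_mult of_real_power)
  have "z / n * cnj (z / n) + 1 / n * cnj (1 / n) = (1 + z * cnj z) / (n * n)"
    using n(1,2) by (simp add: field_simps)
  then have unit: "z / n * cnj (z / n) + 1 / n * cnj (1 / n) = 1" using n by (metis divide_self_if mult_eq_0_iff)
  have "\<alpha> * (z / n)\<^sup>2 + \<beta> * (z / n) * (1 / n) + \<gamma> * (1 / n)\<^sup>2 = (\<alpha> * z\<^sup>2 + \<beta> * z + \<gamma>) / n\<^sup>2"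
    using n(1) by (simp add: power2_eq_square field_simps)
  then have "\<alpha> * (z / n)\<^sup>2 + \<beta> * (z / n) * (1 / n) + \<gamma> * (1 / n)\<^sup>2 = 0" unfolding z by simp
  then show thesis by (rule that[OF unit])
qed

lemma normalize_vector:
  fixes w :: "complex^2"
  obtains a u where "hinner u u = 1" "w = a *s u"
proof (cases "w = 0")
  case True
  have "hinner (axis 1 1) (axis 1 1 :: complex^2) = 1" by (simp add: hinner_axis)
  then show thesis using that[of "axis 1 1" 0] True by simp
next
  case False
  define m where "m = (cmod (w $ 1))\<^sup>2 + (cmod (w $ 2))\<^sup>2"
  have "w $ 1 \<noteq> 0 \<or> w $ 2 \<noteq> 0" using False by (auto simp: vec_eq_iff forall_2)
  then have m: "m > 0" by (auto simp: m_def add_pos_nonneg add_nonneg_pos)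
  have ww: "hinner w w = of_real m"
    unfolding hinner_def sum_2 m_def of_real_add complex_norm_square by (simp add: mult.commute)
  define n where "n = complex_of_real (sqrt m)"
  have n: "n \<noteq> 0" "cnj n = n" "n * n = of_real m"
    using m by (simp_all add: n_def flip: of_real_mult)
  have "hinner (inverse n *s w) (inverse n *s w) = inverse (n * n) * hinner w w"
    by (simp add: hinner_smult_left hinner_smult_right n(2) inverse_mult_distrib)
  also have "\<dots> = 1" unfolding n(3) ww using m by simp
  finally show thesis using that[of "inverse n *s w" n] n by simp
qed

text \<open>The orthogonal complement of a unit vector \<open>u\<close> in two dimensions is the
  line spanned by \<open>perp u\<close>.\<close>

lemma orthogonal_pair_basis:
  fixes w z :: "complex^2"
  assumes "hinner w z = 0"
  obtains a b u where "hinner u u = 1" "w = a *s u" "z = b *s perp u"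
proof (cases "w = 0")
  case True
  obtain b u where u: "hinner u u = 1" "z = b *s u" by (rule normalize_vector)
  \<comment> \<open>When \<open>w = 0\<close> the basis comes from \<open>z\<close> alone. The sign
    is needed because \<open>perp (perp u) = - u\<close>.\<close>
  have "hinner (- perp u) (- perp u) = 1" "perp (- perp u) = u"
    using u(1) by (simp_all add: perp_def hinner_def sum_2 vec_eq_iff forall_2 algebra_simps)
  then show thesis using that[of "- perp u" 0 b] u True by simp
next
  case False
  obtain a u where u: "hinner u u = 1" "w = a *s u" by (rule normalize_vector)
  then have "a \<noteq> 0" using False by auto
  then have uz: "hinner u z = 0" using assms u by (simp add: hinner_smult_left)
  define b where "b = hinner (perp u) z"
  have N: "cnj (u $ 1) * u $ 1 + cnj (u $ 2) * u $ 2 = 1"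
    and O: "cnj (u $ 1) * z $ 1 + cnj (u $ 2) * z $ 2 = 0"
    using u(1) uz by (simp_all add: hinner_def sum_2)
  have "z $ 1 = b * - cnj (u $ 2)" "z $ 2 = b * cnj (u $ 1)"
    unfolding b_def hinner_def perp_def sum_2 using N O by (simp_all, algebra+)
  then have "z = b *s perp u" by (simp add: vec_eq_iff forall_2 perp_def)
  then show thesis using that u by blast
qed

text \<open>It rewrites the identity in \<open>depolarizing\<close> as a sum of projections in
  whichever basis the Schmidt decomposition supplies.\<close>

lemma perp_resolution:
  fixes u :: "complex^2"
  assumes "hinner u u = 1"
  shows "outer u u + outer (perp u) (perp u) = mat 1"
  using assms
  by (simp add: hinner_def sum_2 outer_def perp_def mat_def vec_eq_iff forall_2 algebra_simps)

text \<open>For a unit vector \<open>v\<close>, expand \<psi> as \<open>w\<close> tensor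
  \<open>v\<close> plus \<open>z\<close> tensor \<open>perp v\<close>. Orthogonality of
  \<open>w\<close> and \<open>z\<close> is a binary quadratic equation in the coordinates
  \<open>x\<close>, \<open>y\<close> of \<open>v\<close>, so some \<open>v\<close> solves it. The
  coefficients \<open>a\<close>, \<open>b\<close> are complex.\<close>

lemma schmidt_decomposition:
  fixes \<psi> :: "complex^(2 \<times> 2)"
  obtains u v a b where "hinner u u = 1" "hinner v v = 1"
    "\<forall>i k. \<psi> $ (i, k) = a * (u $ i * v $ k) + b * (perp u $ i * perp v $ k)"
proof -
  let ?p = "\<lambda>i k. \<psi> $ (i, k)"
  obtain x y where xy: "x * cnj x + y * cnj y = 1"
    and q: "(cnj (?p 1 1) * ?p 1 2 + cnj (?p 2 1) * ?p 2 2) * x\<^sup>2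
      + (cnj (?p 1 2) * ?p 1 2 + cnj (?p 2 2) * ?p 2 2
          - cnj (?p 1 1) * ?p 1 1 - cnj (?p 2 1) * ?p 2 1) * x * y
      + (- (cnj (?p 1 2) * ?p 1 1 + cnj (?p 2 2) * ?p 2 1)) * y\<^sup>2 = 0"
    by (rule binary_quadratic_form_isotropic)
  define v :: "complex^2" where "v = vector [x, y]"
  \<comment> \<open>\<open>w\<close> and \<open>z\<close> are the contractions of \<psi> with the
    conjugates of \<open>v\<close> and \<open>perp v\<close>; the form in \<open>q\<close> is
    exactly \<open>hinner w z\<close>.\<close>
  define w :: "complex^2" where "w = (\<chi> i. ?p i 1 * cnj x + ?p i 2 * cnj y)"
  define z :: "complex^2" where "z = (\<chi> i. ?p i 2 * x - ?p i 1 * y)"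
  have "hinner w z = 0"
    unfolding q[symmetric] by (simp add: hinner_def sum_2 w_def z_def power2_eq_square algebra_simps)
  then obtain a b u where u: "hinner u u = 1" "w = a *s u" "z = b *s perp u"
    by (rule orthogonal_pair_basis)
  have "hinner v v = 1" using xy by (simp add: hinner_def sum_2 v_def mult.commute)
  moreover have "?p i k = a * (u $ i * v $ k) + b * (perp u $ i * perp v $ k)" for i k
  proof -
    have "a * (u $ i * v $ k) + b * (perp u $ i * perp v $ k) = w $ i * v $ k + z $ i * perp v $ k"
      by (simp add: u)
    also have "\<dots> = ?p i k"
    proof (cases "k = 1")
      case True
      show ?thesis unfolding True using xy by (simp add: w_def z_def v_def perp_def) algebra
    next
      case False
      then have k: "k = 2" using exhaust_2 by blast
      show ?thesis unfolding k using xy by (simp add: w_def z_def v_def perp_def) algebra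
    qed
    finally show ?thesis by simp
  qed
  ultimately show thesis using that u(1) by blast
qed

section \<open>Separability of X-shaped operators\<close>

lemma sep_cone_outer:
  "0 \<le> c \<Longrightarrow> sep_cone (c *\<^sub>R (outer x x \<otimes>\<^sub>K outer y y))"
  by (intro sep_cone_scaleR sep_cone.kron psd_outer)

text \<open>Averaging the phases \<open>\<omega> = 1, \<i>, -1, -\<i>\<close> of the product vectors
  \<open>(u + X \<omega> p) \<otimes> (v + Y \<omega>\<^sup>* s)\<close> kills every coherence except the one between
  \<open>u \<otimes> v\<close> and \<open>p \<otimes> s\<close>, on which the two phases cancel.\<close>

lemma sep_cone_phase_average:
  fixes u p :: "complex^'m::finite" and v s :: "complex^'n::finite"
  shows "sep_cone (outer u u \<otimes>\<^sub>K outer v v + (cmod Y)\<^sup>2 *\<^sub>R (outer u u \<otimes>\<^sub>K outer s s)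
    + (cmod X)\<^sup>2 *\<^sub>R (outer p p \<otimes>\<^sub>K outer v v) + (cmod (X * Y))\<^sup>2 *\<^sub>R (outer p p \<otimes>\<^sub>K outer s s)
    + cnj (X * Y) *\<^sub>C (outer u p \<otimes>\<^sub>K outer v s) + (X * Y) *\<^sub>C (outer p u \<otimes>\<^sub>K outer s v))"
    (is "sep_cone ?M")
proof -
  let ?P = "\<lambda>\<omega>. (1/4) *\<^sub>R (outer (u + (X * \<omega>) *s p) (u + (X * \<omega>) *s p)
      \<otimes>\<^sub>K outer (v + (Y * cnj \<omega>) *s s) (v + (Y * cnj \<omega>) *s s))"
  have "?P 1 + ?P \<i> + (?P (-1) + ?P (- \<i>)) = ?M"
    by (simp add: vec_eq_iff kron_def outer_def cscale_def scaleR_conv_of_real[where 'a=complex]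
        complex_norm_square del: of_real_power) (simp add: field_simps)
  moreover have "sep_cone (?P 1 + ?P \<i> + (?P (-1) + ?P (- \<i>)))"
    by (intro sep_cone.add sep_cone_outer) auto
  ultimately show ?thesis by simp
qed

text \<open>A multiple of the phase average reproduces \<open>d00\<close>, \<open>d01\<close> and
  the coherence \<open>r\<close> exactly, using up \<open>(cmod r)\<^sup>2 / d01\<close> of
  \<open>d10\<close> and \<open>(cmod r)\<^sup>2 / d00\<close> of \<open>d11\<close>. The two bounds
  on \<open>r\<close> make the remaining diagonal nonnegative.\<close>

lemma sep_cone_X_shape:
  fixes u p :: "complex^'m::finite" and v s :: "complex^'n::finite"
  assumes d: "0 \<le> d00" "0 \<le> d01" "0 \<le> d10" "0 \<le> d11"
    and r: "(cmod r)\<^sup>2 \<le> d00 * d11" "(cmod r)\<^sup>2 \<le> d01 * d10"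
  shows "sep_cone (d00 *\<^sub>R (outer u u \<otimes>\<^sub>K outer v v) + d01 *\<^sub>R (outer u u \<otimes>\<^sub>K outer s s)
    + d10 *\<^sub>R (outer p p \<otimes>\<^sub>K outer v v) + d11 *\<^sub>R (outer p p \<otimes>\<^sub>K outer s s)
    + r *\<^sub>C (outer u p \<otimes>\<^sub>K outer v s) + cnj r *\<^sub>C (outer p u \<otimes>\<^sub>K outer s v))"
    (is "sep_cone ?M")
proof (cases "r = 0")
  case True
  then show ?thesis
    by (simp add: cscale_zero_left) (intro sep_cone.add sep_cone_outer d)
next
  case False
  then have "0 < (cmod r)\<^sup>2" by simp
  then have "0 < d00 * d11" "0 < d01 * d10" using r by linarith+
  then have pos: "0 < d00" "0 < d01" "0 < d10" "0 < d11"
    using d by (simp_all add: zero_less_mult_iff)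
  \<comment> \<open>With overall factor \<open>d00\<close>, the size of \<open>Y\<close> is fixed by
    matching \<open>d01\<close>, and then \<open>X\<close> by
    \<open>d00 * X * Y = cnj r\<close>.\<close>
  define Y X where "Y = complex_of_real (sqrt (d01 / d00))"
    and "X = cnj r / (of_real (sqrt d00) * of_real (sqrt d01))"
  have Y2: "d00 * (cmod Y)\<^sup>2 = d01" using pos by (simp add: Y_def norm_divide power_divide)
  have X2: "d00 * (cmod X)\<^sup>2 = (cmod r)\<^sup>2 / d01"
    using pos by (simp add: X_def norm_divide norm_mult power_divide power_mult_distrib)
  have "sqrt (d01 / d00) * d00 = sqrt d00 * sqrt d01"
    using pos by (simp add: real_sqrt_divide field_simps)
  then have "Y * of_real d00 = of_real (sqrt d00) * of_real (sqrt d01)"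
    by (simp add: Y_def flip: of_real_mult)
  moreover have "complex_of_real (sqrt d00) * of_real (sqrt d01) \<noteq> 0" using pos by simp
  ultimately have XY: "of_real d00 * (X * Y) = cnj r"
    by (simp add: X_def field_simps del: of_real_mult)
  then have XY': "of_real d00 * cnj (X * Y) = r" by (metis complex_cnj_cnj complex_cnj_mult complex_cnj_complex_of_real)
  have XY2: "d00 * (cmod (X * Y))\<^sup>2 = (cmod r)\<^sup>2 / d00"
    using arg_cong[OF XY, of cmod] pos
    by (simp add: norm_mult power2_eq_square field_simps)
      (metis mult.assoc mult.commute)
  let ?A = "outer u u \<otimes>\<^sub>K outer v v + (cmod Y)\<^sup>2 *\<^sub>R (outer u u \<otimes>\<^sub>K outer s s)
    + (cmod X)\<^sup>2 *\<^sub>R (outer p p \<otimes>\<^sub>K outer v v) + (cmod (X * Y))\<^sup>2 *\<^sub>R (outer p p \<otimes>\<^sub>K outer s s)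
    + cnj (X * Y) *\<^sub>C (outer u p \<otimes>\<^sub>K outer v s) + (X * Y) *\<^sub>C (outer p u \<otimes>\<^sub>K outer s v)"
  let ?D = "(d10 - (cmod r)\<^sup>2 / d01) *\<^sub>R (outer p p \<otimes>\<^sub>K outer v v)
    + (d11 - (cmod r)\<^sup>2 / d00) *\<^sub>R (outer p p \<otimes>\<^sub>K outer s s)"
  have sc: "c *\<^sub>R (z *\<^sub>C N) = (of_real c * z) *\<^sub>C N" for c z and N :: "('m \<times> 'n) cmatrix"
    by (simp add: cscale_def vec_eq_iff scaleR_conv_of_real[where 'a=complex])
  have "d00 *\<^sub>R ?A + ?D = ?M"
    unfolding scaleR_add_right scaleR_scaleR sc Y2 X2 XY2 XY XY'
    by (simp add: scaleR_diff_left)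
  moreover have "sep_cone (d00 *\<^sub>R ?A + ?D)"
    using pos r by (intro sep_cone.add sep_cone_outer sep_cone_scaleR sep_cone_phase_average)
      (simp_all add: field_simps)
  ultimately show ?thesis by simp
qed

section \<open>Depolarized two-qubit states\<close>

text \<open>The projections have trace one, so \<open>perp_resolution\<close> splits their identity
  part over the basis. The coherences are traceless and are only scaled.\<close>

lemma depolarizing_outer:
  fixes u :: "complex^2"
  assumes "hinner u u = 1"
  shows "depolarizing q (outer u u) = ((1 + q) / 2) *\<^sub>R outer u u + ((1 - q) / 2) *\<^sub>R outer (perp u) (perp u)"
    and "depolarizing q (outer (perp u) (perp u)) =
      ((1 - q) / 2) *\<^sub>R outer u u + ((1 + q) / 2) *\<^sub>R outer (perp u) (perp u)"
    and "depolarizing q (outer u (perp u)) = q *\<^sub>R outer u (perp u)"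
    and "depolarizing q (outer (perp u) u) = q *\<^sub>R outer (perp u) u"
proof -
  have tr: "trace (outer u u) = 1" "trace (outer (perp u) (perp u)) = 1"
    "trace (outer u (perp u)) = 0" "trace (outer (perp u) u) = 0"
    using assms by (simp_all add: trace_def hinner_def outer_def perp_def sum_2 algebra_simps)
  show "depolarizing q (outer u u) = ((1 + q) / 2) *\<^sub>R outer u u + ((1 - q) / 2) *\<^sub>R outer (perp u) (perp u)"
    "depolarizing q (outer (perp u) (perp u)) =
      ((1 - q) / 2) *\<^sub>R outer u u + ((1 + q) / 2) *\<^sub>R outer (perp u) (perp u)"
    "depolarizing q (outer u (perp u)) = q *\<^sub>R outer u (perp u)"
    "depolarizing q (outer (perp u) u) = q *\<^sub>R outer (perp u) u"
    unfolding depolarizing_def tr perp_resolution[OF assms, symmetric]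
    by (simp_all add: vec_eq_iff cscale_def scaleR_conv_of_real[where 'a=complex] field_simps)
qed

text \<open>Each qubit keeps its basis vector with weight \<open>(1 + q) / 2\<close> and flips it
  with weight \<open>(1 - q) / 2\<close>. Thus \<open>x\<close> stands for no flip,
  \<open>x'\<close> for two, \<open>y\<close> for a flip of the second qubit only and
  \<open>y'\<close> for a flip of the first only.\<close>

lemma tensor_map_depolarizing_schmidt:
  fixes q1 q2 :: real and \<psi> :: "complex^(2 \<times> 2)"
  assumes u: "hinner u u = 1" and v: "hinner v v = 1"
    and \<psi>: "\<And>i k. \<psi> $ (i, k) = a * (u $ i * v $ k) + b * (perp u $ i * perp v $ k)"
  defines "A \<equiv> (cmod a)\<^sup>2" and "B \<equiv> (cmod b)\<^sup>2"
    and "x \<equiv> (1 + q1) / 2 * ((1 + q2) / 2)" and "x' \<equiv> (1 - q1) / 2 * ((1 - q2) / 2)"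
    and "y \<equiv> (1 + q1) / 2 * ((1 - q2) / 2)" and "y' \<equiv> (1 - q1) / 2 * ((1 + q2) / 2)"
    and "r \<equiv> a * cnj b * of_real (q1 * q2)"
  shows "(depolarizing q1 \<otimes>\<^sub>M depolarizing q2) (outer \<psi> \<psi>) =
      (A * x + B * x') *\<^sub>R (outer u u \<otimes>\<^sub>K outer v v)
    + (A * y + B * y') *\<^sub>R (outer u u \<otimes>\<^sub>K outer (perp v) (perp v))
    + (A * y' + B * y) *\<^sub>R (outer (perp u) (perp u) \<otimes>\<^sub>K outer v v)
    + (A * x' + B * x) *\<^sub>R (outer (perp u) (perp u) \<otimes>\<^sub>K outer (perp v) (perp v))
    + r *\<^sub>C (outer u (perp u) \<otimes>\<^sub>K outer v (perp v)) + cnj r *\<^sub>C (outer (perp u) u \<otimes>\<^sub>K outer (perp v) v)"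
proof -
  let ?T = "depolarizing q1 \<otimes>\<^sub>M depolarizing q2"
  have T: "?T (M + N) = ?T M + ?T N" "?T (c *\<^sub>C M) = c *\<^sub>C ?T M" for M N c
    using complex_linear_tensor_map[of "depolarizing q1" "depolarizing q2"]
    by (auto simp: complex_linear_def)
  note K = tensor_map_kron[OF complex_linear_depolarizing complex_linear_depolarizing]
  have "outer \<psi> \<psi> = (a * cnj a) *\<^sub>C (outer u u \<otimes>\<^sub>K outer v v)
    + (a * cnj b) *\<^sub>C (outer u (perp u) \<otimes>\<^sub>K outer v (perp v))
    + (cnj a * b) *\<^sub>C (outer (perp u) u \<otimes>\<^sub>K outer (perp v) v)
    + (b * cnj b) *\<^sub>C (outer (perp u) (perp u) \<otimes>\<^sub>K outer (perp v) (perp v))"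
    by (auto simp: vec_eq_iff outer_def kron_def cscale_def \<psi> algebra_simps)
  then have *: "?T (outer \<psi> \<psi>) = (a * cnj a) *\<^sub>C
        ((((1 + q1) / 2) *\<^sub>R outer u u + ((1 - q1) / 2) *\<^sub>R outer (perp u) (perp u)) \<otimes>\<^sub>K
         (((1 + q2) / 2) *\<^sub>R outer v v + ((1 - q2) / 2) *\<^sub>R outer (perp v) (perp v)))
    + (a * cnj b) *\<^sub>C (q1 *\<^sub>R outer u (perp u) \<otimes>\<^sub>K q2 *\<^sub>R outer v (perp v))
    + (cnj a * b) *\<^sub>C (q1 *\<^sub>R outer (perp u) u \<otimes>\<^sub>K q2 *\<^sub>R outer (perp v) v)
    + (b * cnj b) *\<^sub>C
        ((((1 - q1) / 2) *\<^sub>R outer u u + ((1 + q1) / 2) *\<^sub>R outer (perp u) (perp u)) \<otimes>\<^sub>K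
         (((1 - q2) / 2) *\<^sub>R outer v v + ((1 + q2) / 2) *\<^sub>R outer (perp v) (perp v)))"
    by (simp only: T K depolarizing_outer[OF u] depolarizing_outer[OF v])
  have AB: "a * cnj a = of_real A" "b * cnj b = of_real B"
    by (simp_all add: A_def B_def complex_norm_square del: of_real_power)
  \<comment> \<open>Naming the four weights turns the entrywise comparison into a polynomial
    identity without fractions.\<close>
  define P P' R R' where w: "P = (1 + q1) / 2" "P' = (1 - q1) / 2" "R = (1 + q2) / 2" "R' = (1 - q2) / 2"
  show ?thesis unfolding * AB x_def x'_def y_def y'_def r_def w[symmetric]
    by (simp add: vec_eq_iff kron_def cscale_def scaleR_conv_of_real[where 'a=complex] algebra_simps)
qed

text \<open>The right-hand side equals
  \<open>A * B * (x + y)\<^sup>2 + (A - B)\<^sup>2 * (x * y)\<close>. It will bound both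
  \<open>d00 * d11\<close> and \<open>d01 * d10\<close> from below.\<close>

lemma symmetrized_product_lower_bound:
  fixes A B x y q :: real
  assumes "0 \<le> A" "0 \<le> B" "0 \<le> x" "0 \<le> y" "\<bar>q\<bar> \<le> x + y"
  shows "A * B * q\<^sup>2 \<le> (A * x + B * y) * (A * y + B * x)"
proof -
  have "q\<^sup>2 \<le> (x + y)\<^sup>2" using assms(5) by (metis abs_ge_zero power2_abs power_mono)
  then have "A * B * q\<^sup>2 \<le> A * B * (x + y)\<^sup>2" using assms by (intro mult_left_mono) auto
  also have "\<dots> \<le> A * B * (x + y)\<^sup>2 + (A - B)\<^sup>2 * (x * y)" using assms by simp
  also have "\<dots> = (A * x + B * y) * (A * y + B * x)" by (simp add: power2_eq_square algebra_simps)
  finally show ?thesis .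
qed

lemma depolarizing_params_product:
  fixes q1 q2 :: real
  assumes "q1 \<in> {- 1/3..1}" "q2 \<in> {- 1/3..1}"
  shows "- 1/3 \<le> q1 * q2"
proof (cases "0 \<le> q1")
  case True
  have "q1 * (- 1/3) \<le> q1 * q2" using assms True by (intro mult_left_mono) auto
  then show ?thesis using assms by simp
next
  case False
  have "q1 * 1 \<le> q1 * q2" using assms False by (intro mult_left_mono_neg) auto
  then show ?thesis using assms by simp
qed

lemma sep_cone_depolarized:
  assumes q: "q1 \<in> {- 1/3..1}" "q2 \<in> {- 1/3..1}" "q1 * q2 \<le> 1/3"
    and "positive_semidefinite \<rho>"
  shows "sep_cone ((depolarizing q1 \<otimes>\<^sub>M depolarizing q2) \<rho>)"
  using assms(4)
proof (induction rule: psd_rank_one_induct)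
  case zero
  have "(depolarizing q1 \<otimes>\<^sub>M depolarizing q2) 0 = 0" by (simp add: tensor_map_def cscale_zero_left)
  then show ?case using sep_cone.zero by simp
next
  case (add M \<psi>)
  obtain u v a b where uv: "hinner u u = 1" "hinner v v = 1"
    "\<forall>i k. \<psi> $ (i, k) = a * (u $ i * v $ k) + b * (perp u $ i * perp v $ k)"
    by (rule schmidt_decomposition[of \<psi>])
  let ?A = "(cmod a)\<^sup>2" and ?B = "(cmod b)\<^sup>2"
  let ?x = "(1 + q1) / 2 * ((1 + q2) / 2)" and ?x' = "(1 - q1) / 2 * ((1 - q2) / 2)"
  let ?y = "(1 + q1) / 2 * ((1 - q2) / 2)" and ?y' = "(1 - q1) / 2 * ((1 + q2) / 2)"
  have nonneg: "0 \<le> ?x" "0 \<le> ?x'" "0 \<le> ?y" "0 \<le> ?y'" using q by simp_all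
  have sums: "?x + ?x' = (1 + q1 * q2) / 2" "?y + ?y' = (1 - q1 * q2) / 2"
    by (simp_all add: field_simps)
  \<comment> \<open>The first bound is tight at \<open>c = - 1/3\<close>, the second at
    \<open>c = 1/3\<close>.\<close>
  have "\<bar>c\<bar> \<le> (1 + c) / 2" "\<bar>c\<bar> \<le> (1 - c) / 2" if "- 1/3 \<le> c" "c \<le> 1/3" for c :: real
    using that by (auto simp: abs_if)
  then have bounds: "\<bar>q1 * q2\<bar> \<le> ?x + ?x'" "\<bar>q1 * q2\<bar> \<le> ?y + ?y'"
    unfolding sums using depolarizing_params_product[OF q(1,2)] q(3) by blast+
  have r2: "(cmod (a * cnj b * of_real (q1 * q2)))\<^sup>2 = ?A * ?B * (q1 * q2)\<^sup>2"
    by (simp add: norm_mult power_mult_distrib)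
  have "sep_cone ((depolarizing q1 \<otimes>\<^sub>M depolarizing q2) (outer \<psi> \<psi>))"
    unfolding tensor_map_depolarizing_schmidt[OF uv(1,2) uv(3)[rule_format]]
    by (rule sep_cone_X_shape; (unfold r2)?)
      (intro symmetrized_product_lower_bound add_nonneg_nonneg mult_nonneg_nonneg nonneg bounds
        zero_le_power2)+
  moreover have "(depolarizing q1 \<otimes>\<^sub>M depolarizing q2) (M + outer \<psi> \<psi>) =
      (depolarizing q1 \<otimes>\<^sub>M depolarizing q2) M + (depolarizing q1 \<otimes>\<^sub>M depolarizing q2) (outer \<psi> \<psi>)"
    using complex_linear_tensor_map unfolding complex_linear_def by blast
  ultimately show ?case using add sep_cone.add by simp
qed

text \<open>Supplies the trace-one condition under which cone membership becomes separability. It is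
  checked on products of matrix units.\<close>

lemma trace_tensor_map:
  assumes "trace_preserving \<E>" "trace_preserving \<F>"
  shows "trace ((\<E> \<otimes>\<^sub>M \<F>) X) = trace X"
proof -
  have tr_sum: "trace (\<Sum>i\<in>S. f i) = (\<Sum>i\<in>S. trace (f i))" if "finite S"
    for f :: "'c \<Rightarrow> ('a \<times> 'b) cmatrix" and S
    using that by (induction S) (simp_all add: trace_add, simp add: trace_def)
  have tr_scale: "trace (c *\<^sub>C N) = c * trace N" for c and N :: "('a \<times> 'b) cmatrix"
    by (simp add: trace_def cscale_def sum_distrib_left)
  have "trace ((\<E> \<otimes>\<^sub>M \<F>) X) = (\<Sum>p\<in>UNIV. \<Sum>q\<in>UNIV. X $ p $ q *
      trace (matrix_unit (fst p) (fst q) \<otimes>\<^sub>K matrix_unit (snd p) (snd q)))"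
    using assms by (simp add: tensor_map_def tr_sum tr_scale trace_kron trace_preserving_def)
  also have "\<dots> = trace (\<Sum>p\<in>UNIV. \<Sum>q\<in>UNIV. X $ p $ q *\<^sub>C matrix_unit p q)"
    by (simp add: tr_sum tr_scale kron_matrix_unit)
  finally show ?thesis using cmatrix_expansion[of X] by simp
qed

section \<open>The maximally entangled state\<close>

text \<open>Twice the overlap with the maximally entangled state.\<close>

definition bell_functional :: "two_qubit_op \<Rightarrow> real" where
  "bell_functional M = (\<Sum>i\<in>UNIV. \<Sum>j\<in>UNIV. Re (M $ (i, i) $ (j, j)))"

text \<open>The off-diagonal part is twice the real part of \<open>c\<close>. The minor bounds and
  the inequality of arithmetic and geometric means give
  \<open>2 * Re c \<le> s1 * t2 + s2 * t1\<close>, which completes the diagonal part to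
  \<open>(s1 + s2) * (t1 + t2) = 1\<close>.\<close>

lemma bell_functional_product_le:
  assumes "is_state \<sigma>" "is_state \<tau>"
  shows "bell_functional (\<sigma> \<otimes>\<^sub>K \<tau>) \<le> 1"
proof -
  have psd: "positive_semidefinite \<sigma>" "positive_semidefinite \<tau>"
    and tr: "trace \<sigma> = 1" "trace \<tau> = 1" using assms by (auto simp: is_state_def)
  define s1 s2 t1 t2 where st: "s1 = Re (\<sigma> $ 1 $ 1)" "s2 = Re (\<sigma> $ 2 $ 2)"
    "t1 = Re (\<tau> $ 1 $ 1)" "t2 = Re (\<tau> $ 2 $ 2)"
  have nonneg: "0 \<le> s1" "0 \<le> s2" "0 \<le> t1" "0 \<le> t2"
    and im: "\<And>i. Im (\<sigma> $ i $ i) = 0" "\<And>i. Im (\<tau> $ i $ i) = 0"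
    using psd_diag[OF psd(1)] psd_diag[OF psd(2)] by (simp_all add: st complex_nonneg_Reals_iff)
  have one: "s1 + s2 = 1" "t1 + t2 = 1"
    using arg_cong[OF tr(1), of Re] arg_cong[OF tr(2), of Re] by (simp_all add: trace_def sum_2 st)
  define c where "c = \<sigma> $ 1 $ 2 * \<tau> $ 1 $ 2"
  have "(cmod c)\<^sup>2 \<le> (s1 * s2) * (t1 * t2)"
    unfolding c_def norm_mult power_mult_distrib st
    by (intro mult_mono psd_minor psd) (use nonneg in \<open>simp_all add: st\<close>)
  also have "\<dots> = ((s1 * t2 + s2 * t1) / 2)\<^sup>2 - ((s1 * t2 - s2 * t1) / 2)\<^sup>2"
    by (simp add: power2_eq_square field_simps)
  also have "\<dots> \<le> ((s1 * t2 + s2 * t1) / 2)\<^sup>2" by simp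
  finally have "cmod c \<le> (s1 * t2 + s2 * t1) / 2"
    by (rule power2_le_imp_le) (use nonneg in simp)
  then have "2 * Re c \<le> s1 * t2 + s2 * t1" using complex_Re_le_cmod[of c]
    by (simp only: field_simps)
  moreover have "bell_functional (\<sigma> \<otimes>\<^sub>K \<tau>) = s1 * t1 + s2 * t2 + 2 * Re c"
    using psd_hermitian[OF psd(1), of 2 1] psd_hermitian[OF psd(2), of 2 1] im
    by (simp add: bell_functional_def kron_def sum_2 st c_def)
  moreover have "s1 * t1 + s2 * t2 + (s1 * t2 + s2 * t1) = (s1 + s2) * (t1 + t2)"
    by (simp add: algebra_simps)
  ultimately show ?thesis using one by simp
qed

text \<open>The functional is real-linear, so the bound on product states defines a half-space and
  passes to their convex hull.\<close>

lemma bell_functional_separable_le: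
  assumes "separable M"
  shows "bell_functional M \<le> 1"
proof -
  have "convex {M. bell_functional M \<le> 1}"
  proof (rule convexI)
    fix M N :: two_qubit_op and c d :: real
    assume *: "M \<in> {M. bell_functional M \<le> 1}" "N \<in> {M. bell_functional M \<le> 1}"
      "0 \<le> c" "0 \<le> d" "c + d = 1"
    have "bell_functional (c *\<^sub>R M + d *\<^sub>R N) = c * bell_functional M + d * bell_functional N"
      by (simp add: bell_functional_def sum.distrib sum_distrib_left)
    also have "\<dots> \<le> c * 1 + d * 1" using * by (intro add_mono mult_left_mono) auto
    finally show "c *\<^sub>R M + d *\<^sub>R N \<in> {M. bell_functional M \<le> 1}" using * by simp
  qed
  then have "convex hull {\<sigma> \<otimes>\<^sub>K \<tau> | \<sigma> \<tau>. is_state \<sigma> \<and> is_state \<tau>} \<subseteq> {M. bell_functional M \<le> 1}"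
    by (intro hull_minimal) (auto intro: bell_functional_product_le)
  then show ?thesis using assms by (auto simp: separable_def)
qed

lemma entanglement_annihilating_imp_product_le:
  assumes "entanglement_annihilating (depolarizing q1) (depolarizing q2)"
  shows "q1 * q2 \<le> 1/3"
proof -
  let ?T = "depolarizing q1 \<otimes>\<^sub>M depolarizing q2"
  \<comment> \<open>The maximally entangled vector, left unnormalized with squared norm 2; hence the
    factor \<open>1/2\<close> below.\<close>
  define \<phi> :: "complex^(2 \<times> 2)" where "\<phi> = (\<chi> p. if fst p = snd p then 1 else 0)"
  define u :: "complex^2" where "u = vector [1, 0]"
  have "trace (outer \<phi> \<phi>) = 2" by (simp add: trace_def outer_def \<phi>_def sum_UNIV_prod sum_2)
  then have "is_state ((1/2) *\<^sub>R outer \<phi> \<phi>)"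
    by (simp add: is_state_def trace_scaleR psd_scaleR psd_outer)
  then have "bell_functional (?T ((1/2) *\<^sub>R outer \<phi> \<phi>)) \<le> 1"
    using assms bell_functional_separable_le unfolding entanglement_annihilating_def by blast
  moreover have "?T ((1/2) *\<^sub>R outer \<phi> \<phi>) = (1/2) *\<^sub>R ?T (outer \<phi> \<phi>)"
    by (simp add: tensor_map_def cscale_def vec_eq_iff scaleR_sum_right)
  moreover have "bell_functional ((1/2) *\<^sub>R N) = bell_functional N / 2" for N
    by (simp add: bell_functional_def sum_divide_distrib)
  moreover have "bell_functional (?T (outer \<phi> \<phi>)) = 1 + 3 * (q1 * q2)"
  proof -
    have u: "hinner u u = 1" by (simp add: hinner_def sum_2 u_def)
    \<comment> \<open>A Schmidt form with \<open>a = b = 1\<close> in the standard basis. The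
      diagonal then contributes \<open>1 + q1 * q2\<close> to the functional and the two coherences
      contribute \<open>2 * (q1 * q2)\<close>.\<close>
    have "\<phi> $ (i, k) = 1 * (u $ i * u $ k) + 1 * (perp u $ i * perp u $ k)" for i k
      using exhaust_2[of i] exhaust_2[of k] by (auto simp: \<phi>_def u_def perp_def)
    from tensor_map_depolarizing_schmidt[OF u u this] show ?thesis
      by (simp add: bell_functional_def sum_2 kron_def outer_def cscale_def u_def perp_def field_simps)
  qed
  ultimately show ?thesis by simp
qed

theorem mainTheorem1:
  fixes q1 q2 :: real
  assumes "q1 \<in> {- 1/3..1}" and "q2 \<in> {- 1/3..1}"
  shows "entanglement_annihilating (depolarizing q1) (depolarizing q2) \<longleftrightarrow> q1 * q2 \<le> 1/3"
proof
  assume "q1 * q2 \<le> 1/3"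
  then have "separable ((depolarizing q1 \<otimes>\<^sub>M depolarizing q2) \<rho>)" if "is_state \<rho>" for \<rho>
    using that assms sep_cone_depolarized[of q1 q2 \<rho>]
    by (intro separable_if_sep_cone)
      (simp_all add: is_state_def trace_tensor_map trace_preserving_depolarizing)
  then show "entanglement_annihilating (depolarizing q1) (depolarizing q2)"
    using assms by (simp add: entanglement_annihilating_def qubit_channel_depolarizing)
qed (rule entanglement_annihilating_imp_product_le)

end
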